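(* Let $\chi$ be a functional random variable in $L^{2}(T)$ with mean function $\mu_{\chi}$ and compact covariance operator $\Gamma_{\chi}$, and let $K$ be a positive integer with $\lambda_K>0$. If $\chi$ is a Gaussian process, then $d_{FM}^{K}(\chi,\mu_{\chi})^{2}\sim\chi_{K}^{2}$ (the chi-squared distribution with $K$ degrees of freedom), so that $E\left[d_{FM}^{K}(\chi,\mu_{\chi})^{2}\right]=K$ and $V\left[d_{FM}^{K}(\chi,\mu_{\chi})^{2}\right]=2K$, where $V$ denotes variance.
   Context: $T=[a,b]$ is a closed interval of the real line and $L^{2}(T)$ is the real Hilbert space of square integrable functions on $T$, with inner product $\langle f,g\rangle=\int_T f(t)g(t)\,dt$ and norm $\|\cdot\|_2$. A functional random variable $\chi$ is a random element of $L^2(T)$; it is assumed throughout that $E[\|\chi\|_2^4]<\infty$. Its mean function is $\mu_\chi(t)=E[\chi(t)]$ and its covariance operator is $\Gamma_\chi(\eta)=E[\langle \chi-\mu_\chi,\eta\rangle(\chi-\mu_\chi)]$ for $\eta\in L^2(T)$, which is compact. Let $\lambda_1\ge\lambda_2\ge\cdots\ge 0$ be the eigenvalues of $\Gamma_\chi$ ($\sum_k\lambda_k<\infty$), and let $\psi_1,\psi_2,\ldots$ be a fixed associated sequence of orthonormal eigenfunctions, $\Gamma_\chi(\psi_k)=\lambda_k\psi_k$, forming an orthonormal basis of $L^2(T)$. For functions $f,g$, $(f\otimes f)(g)=\langle f,g\rangle f$. For a positive integer $K$ with $\lambda_K>0$, the regularized square root inverse operator is $$\Gamma_K^{-1/2}(\zeta)=\sum_{k=1}^K\frac{1}{\lambda_k^{1/2}}(\psi_k\otimes\psi_k)(\zeta)=\sum_{k=1}^K\frac{\langle\psi_k,\zeta\rangle}{\lambda_k^{1/2}}\psi_k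 .$$ The functional Mahalanobis semi-distance between $\chi$ and $\mu_\chi$ is $$d_{FM}^K(\chi,\mu_\chi)=\left\langle\Gamma_K^{-1/2}(\chi-\mu_\chi),\Gamma_K^{-1/2}(\chi-\mu_\chi)\right\rangle^{1/2}.$$ *)

theory Defs
  imports "HOL-Probability.Probability"
begin

text \<open>
  Elements of \<open>L\<^sup>2(T)\<close> are represented by square integrable functions \<open>real \<Rightarrow> real\<close>, of which only
  the restriction to \<open>T\<close> matters; equality in \<open>L\<^sup>2(T)\<close> is equality almost everywhere on \<open>T\<close>.
\<close>

definition L2_space :: "real set \<Rightarrow> (real \<Rightarrow> real) set" where
  "L2_space T = {f \<in> borel_measurable (lebesgue_on T). integrable (lebesgue_on T) (\<lambda>t. (f t)\<^sup>2)}"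

definition L2_inner :: "real set \<Rightarrow> (real \<Rightarrow> real) \<Rightarrow> (real \<Rightarrow> real) \<Rightarrow> real" where
  "L2_inner T f g = (LINT t|lebesgue_on T. f t * g t)"

definition L2_norm :: "real set \<Rightarrow> (real \<Rightarrow> real) \<Rightarrow> real" where
  "L2_norm T f = sqrt (L2_inner T f f)"

text \<open>
  A random element of \<open>L\<^sup>2(T)\<close> is given by a jointly measurable process with square integrable
  sample paths, so that the pointwise mean function is meaningful. Joint measurability is what ties
  the random variables \<open>X(t)\<close> to the path as an element of \<open>L\<^sup>2(T)\<close>; conversely every random element of
  \<open>L\<^sup>2(T)\<close> has such a representative.
\<close>

definition functional_rv :: "'w measure \<Rightarrow> real set \<Rightarrow> ('w \<Rightarrow> real \<Rightarrow> real) \<Rightarrow> bool" where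
  "functional_rv M T X \<longleftrightarrow>
     (\<lambda>(\<omega>, t). X \<omega> t) \<in> borel_measurable (M \<Otimes>\<^sub>M lebesgue_on T) \<and>
     (\<forall>\<omega>\<in>space M. X \<omega> \<in> L2_space T)"

definition mean_fun :: "'w measure \<Rightarrow> ('w \<Rightarrow> real \<Rightarrow> real) \<Rightarrow> real \<Rightarrow> real" where
  "mean_fun M X t = (LINT \<omega>|M. X \<omega> t)"

text \<open>
  The expectation of the \<open>L\<^sup>2(T)\<close>-valued variable is taken pointwise in \<open>t\<close>; this agrees with the
  Bochner expectation for almost every \<open>t\<close>.
\<close>

definition cov_op ::
  "'w measure \<Rightarrow> real set \<Rightarrow> ('w \<Rightarrow> real \<Rightarrow> real) \<Rightarrow> (real \<Rightarrow> real) \<Rightarrow> real \<Rightarrow> real" where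
  "cov_op M T X \<eta> t =
     (LINT \<omega>|M. L2_inner T (\<lambda>s. X \<omega> s - mean_fun M X s) \<eta> * (X \<omega> t - mean_fun M X t))"

definition L2_compact_op :: "real set \<Rightarrow> ((real \<Rightarrow> real) \<Rightarrow> real \<Rightarrow> real) \<Rightarrow> bool" where
  "L2_compact_op T A \<longleftrightarrow>
     (\<forall>f\<in>L2_space T. A f \<in> L2_space T) \<and>
     (\<forall>f :: nat \<Rightarrow> real \<Rightarrow> real. (\<forall>n. f n \<in> L2_space T) \<and> bounded (range (\<lambda>n. L2_norm T (f n))) \<longrightarrow>
        (\<exists>r g. strict_mono r \<and> g \<in> L2_space T \<and>
           (\<lambda>n. L2_norm T (\<lambda>t. A (f (r n)) t - g t)) \<longlonglongrightarrow> 0))"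

text \<open>Sequences are indexed from 1; the value at index 0 is irrelevant.\<close>

definition L2_orthonormal_basis :: "real set \<Rightarrow> (nat \<Rightarrow> real \<Rightarrow> real) \<Rightarrow> bool" where
  "L2_orthonormal_basis T \<psi> \<longleftrightarrow>
     (\<forall>k\<ge>1. \<psi> k \<in> L2_space T) \<and>
     (\<forall>j\<ge>1. \<forall>k\<ge>1. L2_inner T (\<psi> j) (\<psi> k) = (if j = k then 1 else 0)) \<and>
     (\<forall>f\<in>L2_space T.
        (\<lambda>n. L2_norm T (\<lambda>t. f t - (\<Sum>k=1..n. L2_inner T (\<psi> k) f * \<psi> k t))) \<longlonglongrightarrow> 0)"

text \<open>
  Since the eigenfunctions form an orthonormal basis, the sequence \<open>lam\<close> lists all eigenvalues
  of \<open>A\<close>, repeated according to multiplicity.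
\<close>

definition eigensystem ::
  "real set \<Rightarrow> ((real \<Rightarrow> real) \<Rightarrow> real \<Rightarrow> real) \<Rightarrow> (nat \<Rightarrow> real) \<Rightarrow> (nat \<Rightarrow> real \<Rightarrow> real) \<Rightarrow> bool" where
  "eigensystem T A lam \<psi> \<longleftrightarrow>
     (\<forall>k\<ge>1. 0 \<le> lam (Suc k) \<and> lam (Suc k) \<le> lam k) \<and>
     summable lam \<and>
     L2_orthonormal_basis T \<psi> \<and>
     (\<forall>k\<ge>1. AE t in lebesgue_on T. A (\<psi> k) t = lam k * \<psi> k t)"

definition tensor_square :: "real set \<Rightarrow> (real \<Rightarrow> real) \<Rightarrow> (real \<Rightarrow> real) \<Rightarrow> real \<Rightarrow> real" where
  "tensor_square T f g t = L2_inner T f g * f t"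

definition reg_inv_sqrt ::
  "real set \<Rightarrow> (nat \<Rightarrow> real) \<Rightarrow> (nat \<Rightarrow> real \<Rightarrow> real) \<Rightarrow> nat \<Rightarrow> (real \<Rightarrow> real) \<Rightarrow> real \<Rightarrow> real" where
  "reg_inv_sqrt T lam \<psi> K \<zeta> t = (\<Sum>k=1..K. 1 / sqrt (lam k) * tensor_square T (\<psi> k) \<zeta> t)"

definition d_FM ::
  "real set \<Rightarrow> (nat \<Rightarrow> real) \<Rightarrow> (nat \<Rightarrow> real \<Rightarrow> real) \<Rightarrow> nat \<Rightarrow> (real \<Rightarrow> real) \<Rightarrow> (real \<Rightarrow> real) \<Rightarrow> real" where
  "d_FM T lam \<psi> K x m =
     sqrt (L2_inner T (reg_inv_sqrt T lam \<psi> K (\<lambda>t. x t - m t)) (reg_inv_sqrt T lam \<psi> K (\<lambda>t. x t - m t)))"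

text \<open>Normal law, the degenerate case of variance \<open>0\<close> included.\<close>

definition normal_rv :: "'w measure \<Rightarrow> ('w \<Rightarrow> real) \<Rightarrow> bool" where
  "normal_rv M Y \<longleftrightarrow> Y \<in> borel_measurable M \<and>
     (\<exists>m. (AE \<omega> in M. Y \<omega> = m) \<or> (\<exists>\<sigma>>0. distributed M lborel Y (normal_density m \<sigma>)))"

text \<open>
  All finite-dimensional distributions are multivariate normal, possibly degenerate: every linear
  combination of finitely many coordinates is normal.
\<close>

definition gaussian_process :: "'w measure \<Rightarrow> real set \<Rightarrow> ('w \<Rightarrow> real \<Rightarrow> real) \<Rightarrow> bool" where
  "gaussian_process M T X \<longleftrightarrow>
     (\<forall>J c. finite J \<and> J \<subseteq> T \<longrightarrow> normal_rv M (\<lambda>\<omega>. \<Sum>t\<in>J. c t * X \<omega> t))"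

definition chi_squared_density :: "nat \<Rightarrow> real \<Rightarrow> real" where
  "chi_squared_density K x =
     (if x \<le> 0 then 0
      else x powr (real K / 2 - 1) * exp (- x / 2) / (2 powr (real K / 2) * Gamma (real K / 2)))"

end

theory Submission
  imports Defs
begin

text \<open>
  Write \<open>Y\<^sub>k = \<langle>\<chi> - \<mu>, \<psi>\<^sub>k\<rangle>\<close> for the scores of \<open>\<chi>\<close> and \<open>Z\<^sub>k = Y\<^sub>k / sqrt \<lambda>\<^sub>k\<close>. Orthonormality of the
  eigenfunctions turns the squared semi-distance into \<open>\<Sum>k\<le>K. Z\<^sub>k\<^sup>2\<close> (\<open>d_FM_square_eq\<close>), so the claim is
  that \<open>Z\<^sub>1, \<dots>, Z\<^sub>K\<close> behave like independent standard normal variables. Since \<open>E[Y\<^sub>j Y\<^sub>k] = \<langle>\<Gamma> \<psi>\<^sub>j, \<psi>\<^sub>k\<rangle>\<close>,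
  the eigenvalue equation gives \<open>E[Z\<^sub>j Z\<^sub>k] = \<delta>\<^sub>j\<^sub>k\<close>; what remains is to see that the scores are jointly
  Gaussian and to pass from there to the law of the sum of squares.

  \<^bold>\<open>Gaussianity of the scores.\<close> The process is Gaussian only in the sense that finite combinations of
  the coordinates \<open>\<chi>(t)\<close> are normal, while a score is an integral over \<open>t\<close>. The integral
  \<open>Y = \<langle>\<chi> - \<mu>, \<phi>\<rangle>\<close> nevertheless lies in the closed linear span of the centred coordinates in \<open>L\<^sup>2\<close> of
  the probability space: its residual \<open>R\<close> with respect to that span is orthogonal to every coordinate,
  so that \<open>E[R Y] = \<integral> \<phi>(t) E[R (\<chi>(t) - \<mu>(t))] dt = 0\<close> by Fubini, which forces \<open>R = 0\<close>
  (\<open>partial_pairing_approximable\<close> runs this argument with a near-minimiser in place of the projection).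
  Centred normal laws are stable under \<open>L\<^sup>2\<close> limits (\<open>gaussian_char_L2_closed\<close>). Applied to
  \<open>\<phi> = \<Sum>k\<le>K. u\<^sub>k \<psi>\<^sub>k / sqrt \<lambda>\<^sub>k\<close> this yields \<open>E[exp(i \<Sum>k\<le>K. u\<^sub>k Z\<^sub>k)] = exp(-\<bar>u\<bar>\<^sup>2 / 2)\<close> for all \<open>u\<close>.

  \<^bold>\<open>Law of the sum of squares.\<close> A uniqueness theorem for characteristic functions of random vectors is
  avoided by randomising \<open>u\<close>: averaging the last identity over \<open>u = sqrt(2s) g\<close> with \<open>g\<close> standard normal
  in dimension \<open>K\<close> gives the Laplace transform \<open>E[exp(-s \<Sum>k\<le>K. Z\<^sub>k\<^sup>2)] = (1 + 2s)\<^bsup>-K/2\<^esup>\<close>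
  (\<open>laplace_sum_squares_of_std_normal_char\<close>). This is also the Laplace transform of the chi-squared
  density, and a law on the half line is determined by its Laplace transform at the natural numbers
  (\<open>real_distribution_eqI_laplace_nat\<close>). Mean and variance are then read off from the Gamma integral.
\<close>

section \<open>Square integrable functions\<close>

text \<open>
  The counterpart of \<open>L2_space\<close> for an arbitrary measure; it is needed on the probability space and on
  its product with the time axis as well as on the time axis itself.
\<close>

definition square_integrable :: "'a measure \<Rightarrow> ('a \<Rightarrow> real) \<Rightarrow> bool" where
  "square_integrable M f \<longleftrightarrow> f \<in> borel_measurable M \<and> integrable M (\<lambda>x. (f x)\<^sup>2)"

lemma square_integrable_measurable[measurable_dest]:
  "square_integrable M f \<Longrightarrow> f \<in> borel_measurable M"
  by (simp add: square_integrable_def)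

lemma square_integrableD: "square_integrable M f \<Longrightarrow> integrable M (\<lambda>x. (f x)\<^sup>2)"
  by (simp add: square_integrable_def)

lemma integrable_mult_square_integrable:
  assumes f: "square_integrable M f" and g: "square_integrable M g"
  shows "integrable M (\<lambda>x. f x * g x)"
proof (rule Bochner_Integration.integrable_bound[where f = "\<lambda>x. (f x)\<^sup>2 + (g x)\<^sup>2"])
  show "integrable M (\<lambda>x. (f x)\<^sup>2 + (g x)\<^sup>2)"
    using f g by (simp add: square_integrableD)
  show "(\<lambda>x. f x * g x) \<in> borel_measurable M"
    using f g by measurable
  have "\<bar>a * b\<bar> \<le> a\<^sup>2 + b\<^sup>2" for a b :: real
    using sum_squares_bound[of a b] sum_squares_bound[of a "- b"] by (auto simp: abs_if)
  then show "AE x in M. norm (f x * g x) \<le> norm ((f x)\<^sup>2 + (g x)\<^sup>2)"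
    by simp
qed

lemma square_integrable_zero[simp]: "square_integrable M (\<lambda>x. 0)"
  by (simp add: square_integrable_def)

lemma square_integrable_cmult:
  "square_integrable M f \<Longrightarrow> square_integrable M (\<lambda>x. c * f x)"
  by (auto simp: square_integrable_def power_mult_distrib)

lemma square_integrable_add:
  assumes f: "square_integrable M f" and g: "square_integrable M g"
  shows "square_integrable M (\<lambda>x. f x + g x)"
  using f g integrable_mult_square_integrable[OF f g]
  by (auto simp: square_integrable_def power2_sum mult.assoc)

lemma square_integrable_diff:
  assumes f: "square_integrable M f" and g: "square_integrable M g"
  shows "square_integrable M (\<lambda>x. f x - g x)"
  using square_integrable_add[OF f square_integrable_cmult[OF g, of "-1"]] by simp

lemma square_integrable_sum:
  "(\<And>i. i \<in> I \<Longrightarrow> square_integrable M (f i)) \<Longrightarrow> square_integrable M (\<lambda>x. \<Sum>i\<in>I. f i x)"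
  by (induction I rule: infinite_finite_induct) (auto intro: square_integrable_add)

text \<open>
  A quadratic without sign change has non-positive discriminant. This gives the Cauchy--Schwarz
  inequality and, in the approximation argument below, its version for near-minimisers.
\<close>

lemma square_le_of_nonneg_quadratic:
  fixes A B D :: real
  assumes q: "\<And>c. 0 \<le> A - 2 * c * B + c\<^sup>2 * D" and D: "0 \<le> D"
  shows "B\<^sup>2 \<le> A * D"
proof (cases "D = 0")
  case True
  have "B = 0"
  proof (rule ccontr)
    assume "B \<noteq> 0"
    with q[of "(A + 1) / (2 * B)"] True show False by simp
  qed
  with True show ?thesis by simp
next
  case False
  with D have "D > 0" by simp
  then have "0 \<le> (A - 2 * (B / D) * B + (B / D)\<^sup>2 * D) * D"
    using q[of "B / D"] by simp
  also have "\<dots> = A * D - B\<^sup>2"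
    using \<open>D > 0\<close> by (simp add: field_simps power2_eq_square)
  finally show ?thesis by simp
qed

lemma integral_square_diff_cmult:
  assumes f: "square_integrable M f" and g: "square_integrable M g"
  shows "(LINT x|M. (f x - c * g x)\<^sup>2)
    = (LINT x|M. (f x)\<^sup>2) - 2 * c * (LINT x|M. f x * g x) + c\<^sup>2 * (LINT x|M. (g x)\<^sup>2)"
proof -
  have "(f x - c * g x)\<^sup>2 = (f x)\<^sup>2 - 2 * c * (f x * g x) + c\<^sup>2 * (g x)\<^sup>2" for x
    by (simp add: power2_eq_square algebra_simps)
  then show ?thesis
    using f g by (simp add: square_integrableD integrable_mult_square_integrable)
qed

lemma integral_Cauchy_Schwarz:
  assumes f: "square_integrable M f" and g: "square_integrable M g"
  shows "(LINT x|M. f x * g x)\<^sup>2 \<le> (LINT x|M. (f x)\<^sup>2) * (LINT x|M. (g x)\<^sup>2)"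
proof (rule square_le_of_nonneg_quadratic)
  fix c
  have "0 \<le> (LINT x|M. (f x - c * g x)\<^sup>2)" by simp
  then show "0 \<le> (LINT x|M. (f x)\<^sup>2) - 2 * c * (LINT x|M. f x * g x) + c\<^sup>2 * (LINT x|M. (g x)\<^sup>2)"
    unfolding integral_square_diff_cmult[OF f g] .
qed simp

lemma (in prob_space) square_integrable_const: "square_integrable M (\<lambda>x. c)"
  by (simp add: square_integrable_def)

lemma (in prob_space) integrable_of_square_integrable:
  "square_integrable M f \<Longrightarrow> integrable M f"
  by (auto simp: square_integrable_def intro: square_integrable_imp_integrable)

lemma (in prob_space) square_expectation_le:
  assumes "square_integrable M f"
  shows "(expectation f)\<^sup>2 \<le> expectation (\<lambda>x. (f x)\<^sup>2)"
  using integral_Cauchy_Schwarz[OF assms square_integrable_const[of 1]] by (simp add: prob_space)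

lemma integral_square_sum_orthonormal:
  fixes u :: "'i \<Rightarrow> real"
  assumes I: "finite I" and f: "\<And>i. i \<in> I \<Longrightarrow> square_integrable M (f i)"
    and orth: "\<And>i j. i \<in> I \<Longrightarrow> j \<in> I \<Longrightarrow> (LINT x|M. f i x * f j x) = (if i = j then 1 else 0)"
  shows "(LINT x|M. (\<Sum>i\<in>I. u i * f i x)\<^sup>2) = (\<Sum>i\<in>I. (u i)\<^sup>2)"
proof -
  have int: "integrable M (\<lambda>x. u i * u j * (f i x * f j x))" if "i \<in> I" "j \<in> I" for i j
    using that by (intro integrable_mult_right integrable_mult_square_integrable f)
  have "(LINT x|M. (\<Sum>i\<in>I. u i * f i x)\<^sup>2) = (LINT x|M. (\<Sum>i\<in>I. \<Sum>j\<in>I. u i * u j * (f i x * f j x)))"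
    by (simp add: power2_eq_square sum_product mult_ac)
  also have "\<dots> = (\<Sum>i\<in>I. LINT x|M. (\<Sum>j\<in>I. u i * u j * (f i x * f j x)))"
    by (intro Bochner_Integration.integral_sum Bochner_Integration.integrable_sum int)
  also have "\<dots> = (\<Sum>i\<in>I. \<Sum>j\<in>I. if i = j then (u j)\<^sup>2 else 0)"
  proof (rule sum.cong[OF refl])
    fix i assume i: "i \<in> I"
    have "(LINT x|M. (\<Sum>j\<in>I. u i * u j * (f i x * f j x))) = (\<Sum>j\<in>I. LINT x|M. u i * u j * (f i x * f j x))"
      using i by (intro Bochner_Integration.integral_sum int)
    also have "\<dots> = (\<Sum>j\<in>I. if i = j then (u j)\<^sup>2 else 0)"
      using i by (intro sum.cong) (auto simp: orth power2_eq_square)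
    finally show "(LINT x|M. (\<Sum>j\<in>I. u i * u j * (f i x * f j x))) = (\<Sum>j\<in>I. if i = j then (u j)\<^sup>2 else 0)" .
  qed
  also have "\<dots> = (\<Sum>i\<in>I. (u i)\<^sup>2)"
    using I by simp
  finally show ?thesis .
qed

section \<open>Integrating out one variable of a square integrable process\<close>

context pair_sigma_finite
begin

lemma square_integrable_tensor:
  assumes f: "square_integrable M1 f" and g: "square_integrable M2 g"
  shows "square_integrable (M1 \<Otimes>\<^sub>M M2) (\<lambda>(x, y). f x * g y)"
  unfolding square_integrable_def
proof
  note [measurable] = square_integrable_measurable[OF f] square_integrable_measurable[OF g]
  show "(\<lambda>(x, y). f x * g y) \<in> borel_measurable (M1 \<Otimes>\<^sub>M M2)" by measurable
  show "integrable (M1 \<Otimes>\<^sub>M M2) (\<lambda>x. (case x of (x, y) \<Rightarrow> f x * g y)\<^sup>2)"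
    using square_integrableD[OF f] square_integrableD[OF g]
    by (intro Fubini_integrable) (auto simp: power_mult_distrib)
qed

lemma integral_pairing:
  assumes R: "square_integrable M1 R" and \<phi>: "square_integrable M2 \<phi>"
    and Z: "square_integrable (M1 \<Otimes>\<^sub>M M2) (\<lambda>(x, y). Z x y)"
  shows "(LINT x|M1. R x * (LINT y|M2. \<phi> y * Z x y)) = (LINT y|M2. \<phi> y * (LINT x|M1. R x * Z x y))"
    and "integrable M2 (\<lambda>y. \<phi> y * (LINT x|M1. R x * Z x y))"
proof -
  have int: "integrable (M1 \<Otimes>\<^sub>M M2) (\<lambda>(x, y). R x * (\<phi> y * Z x y))"
    using integrable_mult_square_integrable[OF square_integrable_tensor[OF R \<phi>] Z]
    by (simp add: split_beta' mult.assoc)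
  have out: "(LINT x|M1. R x * (\<phi> y * Z x y)) = \<phi> y * (LINT x|M1. R x * Z x y)" for y
    by (subst integral_mult_right_zero[symmetric]) (simp only: mult.left_commute)
  show "(LINT x|M1. R x * (LINT y|M2. \<phi> y * Z x y)) = (LINT y|M2. \<phi> y * (LINT x|M1. R x * Z x y))"
    using Fubini_integral[OF int] by (simp add: out)
  show "integrable M2 (\<lambda>y. \<phi> y * (LINT x|M1. R x * Z x y))"
    using integrable_snd[OF int] by (simp add: out)
qed

lemma square_integrable_partial_pairing:
  assumes \<phi>: "square_integrable M2 \<phi>"
    and Z: "square_integrable (M1 \<Otimes>\<^sub>M M2) (\<lambda>(x, y). Z x y)"
  shows "square_integrable M1 (\<lambda>x. LINT y|M2. \<phi> y * Z x y)"
  unfolding square_integrable_def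
proof
  note [measurable] = square_integrable_measurable[OF \<phi>] square_integrable_measurable[OF Z]
  show meas: "(\<lambda>x. LINT y|M2. \<phi> y * Z x y) \<in> borel_measurable M1" by measurable
  have Z2: "integrable (M1 \<Otimes>\<^sub>M M2) (\<lambda>(x, y). (Z x y)\<^sup>2)"
    using square_integrableD[OF Z] by (simp add: split_beta')
  show "integrable M1 (\<lambda>x. (LINT y|M2. \<phi> y * Z x y)\<^sup>2)"
  proof (rule Bochner_Integration.integrable_bound)
    show "integrable M1 (\<lambda>x. (LINT y|M2. (\<phi> y)\<^sup>2) * (LINT y|M2. (Z x y)\<^sup>2))"
      using integrable_fst[OF Z2] by simp
    show "AE x in M1. norm ((LINT y|M2. \<phi> y * Z x y)\<^sup>2) \<le> norm ((LINT y|M2. (\<phi> y)\<^sup>2) * (LINT y|M2. (Z x y)\<^sup>2))"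
      using AE_integrable_fst[OF Z2] AE_space
    proof eventually_elim
      case (elim x)
      then have "square_integrable M2 (Z x)"
        by (simp add: square_integrable_def)
      from integral_Cauchy_Schwarz[OF \<phi> this] show ?case by simp
    qed
  qed (use meas in measurable)
qed

text \<open>
  The integral \<open>Y = \<integral> \<phi>(y) Z(\<cdot>, y) dy\<close> is a limit in mean square of finite combinations of the
  coordinates \<open>Z(\<cdot>, y)\<close>. Let \<open>D\<close> be the infimum of \<open>E(Y - v)\<^sup>2\<close> over such combinations \<open>v\<close>, and let \<open>v\<close>
  come within \<open>\<delta>\<^sup>2\<close> of it, with residual \<open>R = Y - v\<close>. Perturbing \<open>v\<close> cannot lower the error below \<open>D\<close>, so
  \<open>R\<close> is orthogonal up to order \<open>\<delta>\<close> to every coordinate, hence by Fubini to \<open>Y\<close>, and also to \<open>v\<close>. Thus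
  \<open>D \<le> E[R\<^sup>2] = E[R Y] - E[R v] = O(\<delta>)\<close>. Because coordinates are evaluated at single points, they have to
  be square integrable at every point, not merely at almost every one.
\<close>

lemma partial_pairing_approximable:
  fixes Z :: "'a \<Rightarrow> 'b \<Rightarrow> real"
  assumes \<phi>: "square_integrable M2 \<phi>"
    and Z: "square_integrable (M1 \<Otimes>\<^sub>M M2) (\<lambda>(x, y). Z x y)"
    and coord: "\<And>y. y \<in> space M2 \<Longrightarrow> square_integrable M1 (\<lambda>x. Z x y)"
    and "0 < \<epsilon>"
  shows "\<exists>J c. finite J \<and> J \<subseteq> space M2 \<and>
    (LINT x|M1. ((LINT y|M2. \<phi> y * Z x y) - (\<Sum>y\<in>J. c y * Z x y))\<^sup>2) < \<epsilon>"
proof -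
  define Y where "Y x = (LINT y|M2. \<phi> y * Z x y)" for x
  define V where "V = {\<lambda>x. \<Sum>y\<in>J. c y * Z x y |J c. finite J \<and> J \<subseteq> space M2}"
  define err where "err v = (LINT x|M1. (Y x - v x)\<^sup>2)" for v
  define D where "D = Inf (err ` V)"
  have Y: "square_integrable M1 Y"
    unfolding Y_def using \<phi> Z by (rule square_integrable_partial_pairing)
  have V: "square_integrable M1 v" if "v \<in> V" for v
    using that coord unfolding V_def
    by (auto intro!: square_integrable_sum square_integrable_cmult)
  have V_zero: "(\<lambda>x. 0) \<in> V"
    unfolding V_def by (auto intro!: exI[of _ "{}"])
  have V_scale: "(\<lambda>x. a * v x) \<in> V" if "v \<in> V" for a v
  proof -
    from that obtain J c where J: "finite J" "J \<subseteq> space M2" "v = (\<lambda>x. \<Sum>y\<in>J. c y * Z x y)"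
      unfolding V_def by auto
    then have "(\<lambda>x. a * v x) = (\<lambda>x. \<Sum>y\<in>J. (a * c y) * Z x y)"
      by (simp add: sum_distrib_left mult.assoc)
    with J show ?thesis
      unfolding V_def by (auto intro!: exI[of _ J] exI[of _ "\<lambda>y. a * c y"])
  qed
  have V_add: "(\<lambda>x. v x + a * Z x y) \<in> V" if v: "v \<in> V" and y: "y \<in> space M2" for a v y
  proof -
    from v obtain J c where J: "finite J" "J \<subseteq> space M2" "v = (\<lambda>x. \<Sum>y\<in>J. c y * Z x y)"
      unfolding V_def by auto
    \<comment> \<open>The new point may already belong to \<open>J\<close>; its two coefficients then have to be added.\<close>
    let ?c = "\<lambda>z. (if z \<in> J then c z else 0) + (if z = y then a else 0)"
    have "(\<Sum>z\<in>insert y J. ?c z * Z x z) = v x + a * Z x y" for x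
    proof -
      have "(\<Sum>z\<in>insert y J. ?c z * Z x z)
          = (\<Sum>z\<in>insert y J. (if z \<in> J then c z * Z x z else 0) + (if z = y then a * Z x z else 0))"
        by (rule sum.cong) (auto simp: algebra_simps)
      also have "\<dots> = (\<Sum>z\<in>insert y J. if z \<in> J then c z * Z x z else 0) + a * Z x y"
        using J by (simp add: sum.distrib)
      also have "(\<Sum>z\<in>insert y J. if z \<in> J then c z * Z x z else 0) = v x"
        unfolding J(3) using J(1) by (intro sum.mono_neutral_cong_right) auto
      finally show ?thesis .
    qed
    then have "(\<lambda>x. v x + a * Z x y) = (\<lambda>x. \<Sum>z\<in>insert y J. ?c z * Z x z)" by simp
    with J y show ?thesis
      unfolding V_def by (intro CollectI exI[of _ "insert y J"] exI[of _ ?c]) auto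
  qed
  have bdd: "bdd_below (err ` V)"
    unfolding err_def by (rule bdd_belowI2[of _ 0]) simp
  have D_le: "D \<le> err v" if "v \<in> V" for v
    unfolding D_def using bdd that by (intro cInf_lower) auto
  have D0: "0 \<le> D"
    unfolding D_def using V_zero by (intro cInf_greatest) (auto simp: err_def)
  define C where "C = (LINT y|M2. (\<phi> y)\<^sup>2) + (LINT y|M2. LINT x|M1. (Z x y)\<^sup>2) + 1 + 4 * err (\<lambda>x. 0) + 2"
  have Z2: "integrable (M1 \<Otimes>\<^sub>M M2) (\<lambda>(x, y). (Z x y)\<^sup>2)"
    using square_integrableD[OF Z] by (simp add: split_beta')
  have D_small: "2 * D \<le> \<delta> * C" if \<delta>: "0 < \<delta>" "\<delta> \<le> 1" for \<delta>
  proof -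
    have "\<exists>v\<in>V. err v < D + \<delta>\<^sup>2"
      using cInf_lessD[of "err ` V" "D + \<delta>\<^sup>2"] V_zero \<delta> unfolding D_def by auto
    then obtain v where v: "v \<in> V" and v_err: "err v < D + \<delta>\<^sup>2" by blast
    define R where "R x = Y x - v x" for x
    have R: "square_integrable M1 R"
      unfolding R_def by (intro square_integrable_diff Y V v)
    have R_err: "(LINT x|M1. (R x)\<^sup>2) = err v" by (simp add: R_def err_def)
    have almost_orthogonal: "(LINT x|M1. R x * w x)\<^sup>2 \<le> \<delta>\<^sup>2 * (LINT x|M1. (w x)\<^sup>2)"
      if w: "square_integrable M1 w" and w_V: "\<And>a. (\<lambda>x. v x + a * w x) \<in> V" for w
    proof (rule square_le_of_nonneg_quadratic)
      fix a
      have "D \<le> err (\<lambda>x. v x + a * w x)" by (intro D_le w_V)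
      also have "\<dots> = (LINT x|M1. (R x - a * w x)\<^sup>2)"
        by (simp add: err_def R_def diff_diff_eq)
      also have "\<dots> = err v - 2 * a * (LINT x|M1. R x * w x) + a\<^sup>2 * (LINT x|M1. (w x)\<^sup>2)"
        unfolding integral_square_diff_cmult[OF R w] R_err ..
      finally show "0 \<le> \<delta>\<^sup>2 - 2 * a * (LINT x|M1. R x * w x) + a\<^sup>2 * (LINT x|M1. (w x)\<^sup>2)"
        using v_err by simp
    qed simp
    \<comment> \<open>The weight is put on \<open>p\<close> so that, with \<open>p = \<phi> y\<close>, the bound is integrable in \<open>y\<close>.\<close>
    have am_gm: "2 * \<bar>p * b\<bar> \<le> \<delta> * (p\<^sup>2 + s)" if "b\<^sup>2 \<le> \<delta>\<^sup>2 * s" "0 \<le> s" for p b s :: real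
    proof -
      have "\<bar>b\<bar> \<le> \<delta> * sqrt s"
        using that \<delta> real_sqrt_le_mono[OF that(1)] by (simp add: real_sqrt_mult)
      then have "\<bar>p * b\<bar> \<le> \<bar>p\<bar> * (\<delta> * sqrt s)"
        unfolding abs_mult by (intro mult_left_mono) auto
      then have "2 * \<bar>p * b\<bar> \<le> \<delta> * (2 * \<bar>p\<bar> * sqrt s)" by (simp add: mult_ac)
      also have "\<dots> \<le> \<delta> * (p\<^sup>2 + s)"
        using sum_squares_bound[of "\<bar>p\<bar>" "sqrt s"] that \<delta> by (intro mult_left_mono) auto
      finally show ?thesis .
    qed
    have RY: "2 * \<bar>LINT x|M1. R x * Y x\<bar> \<le> \<delta> * ((LINT y|M2. (\<phi> y)\<^sup>2) + (LINT y|M2. LINT x|M1. (Z x y)\<^sup>2))"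
    proof -
      have "2 * \<bar>LINT x|M1. R x * Y x\<bar> = \<bar>LINT y|M2. 2 * (\<phi> y * (LINT x|M1. R x * Z x y))\<bar>"
        unfolding Y_def integral_pairing(1)[OF R \<phi> Z] by (simp add: abs_mult)
      also have "\<dots> \<le> (LINT y|M2. \<bar>2 * (\<phi> y * (LINT x|M1. R x * Z x y))\<bar>)"
        by (rule integral_abs_bound)
      also have "\<dots> \<le> (LINT y|M2. \<delta> * ((\<phi> y)\<^sup>2 + (LINT x|M1. (Z x y)\<^sup>2)))"
      proof (rule integral_mono)
        fix y assume y: "y \<in> space M2"
        have "2 * \<bar>\<phi> y * (LINT x|M1. R x * Z x y)\<bar> \<le> \<delta> * ((\<phi> y)\<^sup>2 + (LINT x|M1. (Z x y)\<^sup>2))"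
          by (intro am_gm almost_orthogonal coord V_add v y) simp
        then show "\<bar>2 * (\<phi> y * (LINT x|M1. R x * Z x y))\<bar> \<le> \<delta> * ((\<phi> y)\<^sup>2 + (LINT x|M1. (Z x y)\<^sup>2))"
          by (simp add: abs_mult)
      qed (use integral_pairing(2)[OF R \<phi> Z] integrable_snd[OF Z2] \<phi> in \<open>auto simp: square_integrableD\<close>)
      also have "\<dots> = \<delta> * ((LINT y|M2. (\<phi> y)\<^sup>2) + (LINT y|M2. LINT x|M1. (Z x y)\<^sup>2))"
        using integrable_snd[OF Z2] \<phi> by (simp add: square_integrableD)
      finally show ?thesis .
    qed
    have Rv: "2 * \<bar>LINT x|M1. R x * v x\<bar> \<le> \<delta> * (1 + (LINT x|M1. (v x)\<^sup>2))"
    proof -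
      have "(\<lambda>x. v x + a * v x) \<in> V" for a
        using V_scale[OF v, of "1 + a"] by (simp add: algebra_simps)
      from am_gm[OF almost_orthogonal[OF V[OF v] this], of 1] show ?thesis by simp
    qed
    \<comment> \<open>A bound on \<open>v\<close> that does not depend on \<open>\<delta>\<close>.\<close>
    have v2: "(LINT x|M1. (v x)\<^sup>2) \<le> 4 * err (\<lambda>x. 0) + 2"
    proof -
      have "(LINT x|M1. (v x)\<^sup>2) \<le> (LINT x|M1. 2 * (Y x)\<^sup>2 + 2 * (R x)\<^sup>2)"
      proof (rule integral_mono)
        show "(v x)\<^sup>2 \<le> 2 * (Y x)\<^sup>2 + 2 * (R x)\<^sup>2" for x
          using zero_le_power2[of "Y x + R x"]
          unfolding R_def by (simp add: power2_eq_square algebra_simps)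
      qed (use V[OF v] Y R in \<open>auto simp: square_integrableD\<close>)
      also have "\<dots> = 2 * err (\<lambda>x. 0) + 2 * err v"
        using Y R by (simp add: square_integrableD R_err) (simp add: err_def)
      also have "err v \<le> err (\<lambda>x. 0) + 1"
        using v_err D_le[OF V_zero] power_le_one[of \<delta> 2] \<delta> by linarith
      finally show ?thesis by simp
    qed
    have "(LINT x|M1. (R x)\<^sup>2) = (LINT x|M1. R x * Y x) - (LINT x|M1. R x * v x)"
      using integrable_mult_square_integrable[OF R Y] integrable_mult_square_integrable[OF R V[OF v]]
      by (simp add: R_def power2_eq_square algebra_simps flip: Bochner_Integration.integral_diff)
    then have "2 * D \<le> 2 * \<bar>LINT x|M1. R x * Y x\<bar> + 2 * \<bar>LINT x|M1. R x * v x\<bar>"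
      using D_le[OF v] R_err by linarith
    also have "\<dots> \<le> \<delta> * ((LINT y|M2. (\<phi> y)\<^sup>2) + (LINT y|M2. LINT x|M1. (Z x y)\<^sup>2))
        + \<delta> * (1 + (4 * err (\<lambda>x. 0) + 2))"
      using RY Rv v2 \<delta> by (intro add_mono order_trans[OF Rv] mult_left_mono) auto
    also have "\<dots> = \<delta> * C" by (simp add: C_def algebra_simps)
    finally show ?thesis .
  qed
  have "D < \<epsilon>"
  proof -
    have C: "C > 0"
      unfolding C_def err_def by (intro add_nonneg_pos add_nonneg_nonneg integral_nonneg_AE) auto
    define \<delta> where "\<delta> = min 1 (\<epsilon> / C)"
    have "2 * D \<le> \<delta> * C"
      using C \<open>0 < \<epsilon>\<close> by (intro D_small) (auto simp: \<delta>_def)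
    also have "\<dots> \<le> \<epsilon> / C * C"
      using C by (intro mult_right_mono) (auto simp: \<delta>_def)
    finally show ?thesis using C \<open>0 < \<epsilon>\<close> by simp
  qed
  then obtain v where "v \<in> V" "err v < \<epsilon>"
    using cInf_lessD[of "err ` V" \<epsilon>] V_zero unfolding D_def by auto
  then show ?thesis
    unfolding V_def err_def Y_def by auto
qed

end

section \<open>Normal variables and their limits in mean square\<close>

lemma norm_iexp_diff_le: "norm (iexp a - iexp b) \<le> \<bar>a - b\<bar>"
proof -
  have "iexp a - iexp b = iexp b * (iexp (a - b) - 1)"
    by (simp add: algebra_simps flip: exp_add)
  then show ?thesis
    using iexp_approx1[of "a - b" 0] by (simp add: norm_mult)
qed

text \<open>
  Both sides of the characteristic identity are continuous in mean square: the left one since \<open>exp(i x)\<close>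
  is 1-Lipschitz, the right one since the second moment is. Only the frequency 1 is considered;
  other frequencies are reached by rescaling the variable.
\<close>

lemma (in prob_space) gaussian_char_L2_closed:
  assumes Y: "square_integrable M Y"
    and approx: "\<And>\<epsilon>. 0 < \<epsilon> \<Longrightarrow> \<exists>V. square_integrable M V \<and> expectation (\<lambda>x. (Y x - V x)\<^sup>2) < \<epsilon>
       \<and> (LINT x|M. iexp (V x)) = complex_of_real (exp (- expectation (\<lambda>x. (V x)\<^sup>2) / 2))"
  shows "(LINT x|M. iexp (Y x)) = complex_of_real (exp (- expectation (\<lambda>x. (Y x)\<^sup>2) / 2))"
proof -
  have "\<forall>n. \<exists>V. square_integrable M V \<and> expectation (\<lambda>x. (Y x - V x)\<^sup>2) < 1 / real (Suc n)
       \<and> (LINT x|M. iexp (V x)) = complex_of_real (exp (- expectation (\<lambda>x. (V x)\<^sup>2) / 2))"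
    by (intro allI approx) simp
  from choice[OF this] obtain V where V: "\<And>n. square_integrable M (V n)"
    and err: "\<And>n. expectation (\<lambda>x. (Y x - V n x)\<^sup>2) < 1 / real (Suc n)"
    and char: "\<And>n. (LINT x|M. iexp (V n x)) = complex_of_real (exp (- expectation (\<lambda>x. (V n x)\<^sup>2) / 2))"
    by auto
  define e where "e n = expectation (\<lambda>x. (Y x - V n x)\<^sup>2)" for n
  have e: "e \<longlonglongrightarrow> 0"
  proof (rule tendsto_sandwich[OF _ _ tendsto_const LIMSEQ_inverse_real_of_nat])
    show "\<forall>\<^sub>F n in sequentially. e n \<le> inverse (real (Suc n))"
      using err by (auto simp: e_def inverse_eq_divide intro!: always_eventually less_imp_le)
  qed (simp add: e_def)
  have R: "square_integrable M (\<lambda>x. Y x - V n x)" for n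
    using Y V by (rule square_integrable_diff)
  note [measurable] = square_integrable_measurable[OF Y] square_integrable_measurable[OF V]
  have int: "integrable M (\<lambda>x. iexp (f x))" if "f \<in> borel_measurable M" for f :: "'a \<Rightarrow> real"
    using that by (intro integrable_iexp) auto
  have "(\<lambda>n. (LINT x|M. iexp (V n x)) - (LINT x|M. iexp (Y x))) \<longlonglongrightarrow> 0"
  proof (rule Lim_null_comparison)
    show "(\<lambda>n. sqrt (e n)) \<longlonglongrightarrow> 0"
      using tendsto_real_sqrt[OF e] by simp
    show "\<forall>\<^sub>F n in sequentially. norm ((LINT x|M. iexp (V n x)) - (LINT x|M. iexp (Y x))) \<le> sqrt (e n)"
    proof (intro always_eventually allI)
      fix n
      have "norm ((LINT x|M. iexp (V n x)) - (LINT x|M. iexp (Y x)))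
          = norm (LINT x|M. iexp (V n x) - iexp (Y x))"
        by (subst Bochner_Integration.integral_diff) (auto intro!: int)
      also have "\<dots> \<le> (LINT x|M. norm (iexp (V n x) - iexp (Y x)))"
        by (rule integral_norm_bound)
      also have "\<dots> \<le> (LINT x|M. \<bar>Y x - V n x\<bar>)"
        using norm_iexp_diff_le[of "V n x" "Y x" for x] integrable_of_square_integrable[OF R]
        by (intro integral_mono integrable_norm integrable_abs) (auto simp: abs_minus_commute intro!: int)
      also have "\<dots> \<le> sqrt (e n)"
        using square_expectation_le[of "\<lambda>x. \<bar>Y x - V n x\<bar>"] R[of n]
        by (intro real_le_rsqrt) (auto simp: e_def square_integrable_def)
      finally show "norm ((LINT x|M. iexp (V n x)) - (LINT x|M. iexp (Y x))) \<le> sqrt (e n)" .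
    qed
  qed
  then have 1: "(\<lambda>n. LINT x|M. iexp (V n x)) \<longlonglongrightarrow> (LINT x|M. iexp (Y x))"
    by (simp add: LIM_zero_iff)
  have "(\<lambda>n. expectation (\<lambda>x. (V n x)\<^sup>2) - expectation (\<lambda>x. (Y x)\<^sup>2)) \<longlonglongrightarrow> 0"
  proof (rule Lim_null_comparison)
    let ?B = "expectation (\<lambda>x. (Y x)\<^sup>2)"
    show "(\<lambda>n. e n + 2 * sqrt (?B * e n)) \<longlonglongrightarrow> 0"
      using tendsto_add[OF e tendsto_mult_left[OF tendsto_real_sqrt[OF tendsto_mult_left[OF e, of ?B]], of 2]]
      by simp
    show "\<forall>\<^sub>F n in sequentially. norm (expectation (\<lambda>x. (V n x)\<^sup>2) - ?B) \<le> e n + 2 * sqrt (?B * e n)"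
    proof (intro always_eventually allI)
      fix n
      let ?c = "expectation (\<lambda>x. Y x * (Y x - V n x))"
      have "expectation (\<lambda>x. (V n x)\<^sup>2) = expectation (\<lambda>x. (Y x - 1 * (Y x - V n x))\<^sup>2)" by simp
      also have "\<dots> = ?B - 2 * ?c + e n"
        unfolding integral_square_diff_cmult[OF Y R] e_def by simp
      finally have "expectation (\<lambda>x. (V n x)\<^sup>2) - ?B = e n - 2 * ?c" by simp
      moreover have "\<bar>?c\<bar> \<le> sqrt (?B * e n)"
        using integral_Cauchy_Schwarz[OF Y R[of n]] unfolding e_def
        by (metis real_sqrt_abs real_sqrt_le_mono)
      moreover have "0 \<le> e n" by (simp add: e_def)
      ultimately show "norm (expectation (\<lambda>x. (V n x)\<^sup>2) - ?B) \<le> e n + 2 * sqrt (?B * e n)"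
        by (simp add: abs_if split: if_splits)
    qed
  qed
  then have "(\<lambda>n. expectation (\<lambda>x. (V n x)\<^sup>2)) \<longlonglongrightarrow> expectation (\<lambda>x. (Y x)\<^sup>2)"
    by (simp add: LIM_zero_iff)
  then have "(\<lambda>n. complex_of_real (exp (- expectation (\<lambda>x. (V n x)\<^sup>2) / 2)))
      \<longlonglongrightarrow> complex_of_real (exp (- expectation (\<lambda>x. (Y x)\<^sup>2) / 2))"
    by (intro tendsto_intros) auto
  with 1 show ?thesis
    unfolding char by (rule LIMSEQ_unique)
qed

text \<open>
  In terms of characteristic functions the degenerate normal law is no exception, which is why this form
  is used instead of densities.
\<close>

lemma (in prob_space) normal_rv_centered:
  assumes "normal_rv M V"
  shows "square_integrable M V"
    and "(LINT x|M. iexp (V x - expectation V))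
      = complex_of_real (exp (- expectation (\<lambda>x. (V x - expectation V)\<^sup>2) / 2))"
proof -
  have V[measurable]: "V \<in> borel_measurable M"
    using assms by (simp add: normal_rv_def)
  consider m where "AE x in M. V x = m" | m \<sigma> where "0 < \<sigma>" "distributed M lborel V (normal_density m \<sigma>)"
    using assms unfolding normal_rv_def by auto
  then have "square_integrable M V \<and> (LINT x|M. iexp (V x - expectation V))
      = complex_of_real (exp (- expectation (\<lambda>x. (V x - expectation V)\<^sup>2) / 2))"
  proof cases
    case (1 m)
    have "integrable M (\<lambda>x. (V x)\<^sup>2) \<longleftrightarrow> integrable M (\<lambda>x. m\<^sup>2)"
      using 1 by (intro integrable_cong_AE) auto
    then have sq: "square_integrable M V"
      by (simp add: square_integrable_def)
    have "expectation V = expectation (\<lambda>x. m)"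
      using 1 by (intro integral_cong_AE) auto
    then have m: "expectation V = m"
      by (simp add: prob_space)
    have "(LINT x|M. iexp (V x - m)) = (LINT x|M. 1)"
      using 1 by (intro integral_cong_AE) auto
    then have char: "(LINT x|M. iexp (V x - m)) = 1"
      by (simp add: prob_space)
    have "expectation (\<lambda>x. (V x - m)\<^sup>2) = expectation (\<lambda>x. 0)"
      using 1 by (intro integral_cong_AE) auto
    then have var: "expectation (\<lambda>x. (V x - m)\<^sup>2) = 0"
      by simp
    show ?thesis
      unfolding m char var using sq by simp
  next
    case (2 m \<sigma>)
    let ?W = "\<lambda>x. (V x - m) / \<sigma>"
    have W: "distributed M lborel ?W std_normal_density"
      using 2 by (rule normal_standard_normal_convert[THEN iffD1])
    have [measurable]: "?W \<in> borel_measurable M" by measurable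
    have m: "expectation V = m" and var: "variance V = \<sigma>\<^sup>2"
      using 2 by (auto intro: normal_distributed_expectation normal_distributed_variance)
    have "integrable M (\<lambda>x. (?W x)\<^sup>2)"
      using distributed_integrable[OF W, of "\<lambda>x. x\<^sup>2"] integrable_std_normal_moment[of 2] by simp
    then have "square_integrable M ?W"
      by (simp add: square_integrable_def)
    then have "square_integrable M (\<lambda>x. \<sigma> * ?W x + m)"
      by (intro square_integrable_add square_integrable_cmult square_integrable_const)
    moreover have "(\<lambda>x. \<sigma> * ?W x + m) = V"
      using 2 by auto
    ultimately have "square_integrable M V" by simp
    moreover have "(LINT x|M. iexp (V x - m)) = char (distr M lborel ?W) \<sigma>"
      using 2 by (simp add: char_def integral_distr)
    then have "(LINT x|M. iexp (V x - m)) = complex_of_real (exp (- \<sigma>\<^sup>2 / 2))"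
      unfolding distributed_distr_eq_density[OF W] char_std_normal_distribution .
    ultimately show ?thesis
      using m var by simp
  qed
  then show "square_integrable M V"
    and "(LINT x|M. iexp (V x - expectation V))
      = complex_of_real (exp (- expectation (\<lambda>x. (V x - expectation V)\<^sup>2) / 2))"
    by auto
qed

section \<open>Sums of squares and the chi-squared law\<close>

text \<open>
  Under \<open>x \<mapsto> exp(-x)\<close> the law is moved to the unit interval, where the Laplace transform at \<open>n\<close> becomes
  the \<open>n\<close>-th moment. On a bounded set moments determine the characteristic function, by integrating the
  exponential series term by term, and hence the law.
\<close>

lemma real_distribution_eqI_laplace_nat:
  fixes M N :: "real measure"
  assumes M: "real_distribution M" and N: "real_distribution N"
    and M0: "AE x in M. 0 \<le> x" and N0: "AE x in N. 0 \<le> x"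
    and eq: "\<And>n::nat. (LINT x|M. exp (- real n * x)) = (LINT x|N. exp (- real n * x))"
  shows "M = N"
proof -
  let ?c = "\<lambda>t n. (\<i> * complex_of_real t) ^ n / fact n"
  have char_series:
    "(\<lambda>m. \<Sum>n<m. ?c t n * complex_of_real (LINT x|D. exp (- real n * x)))
       \<longlonglongrightarrow> char (distr D borel (\<lambda>x. exp (- x))) t"
    if D: "real_distribution D" and D0: "AE x in D. 0 \<le> x" for D :: "real measure" and t :: real
  proof -
    interpret D: real_distribution D by (rule D)
    let ?s = "\<lambda>m x. \<Sum>n<m. ?c t n * complex_of_real (exp (- real n * x))"
    have int: "integrable D (\<lambda>x. complex_of_real (exp (- real n * x)))" for n
      using D0 by (intro D.integrable_const_bound[of _ 1]) (auto elim!: eventually_mono)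
    have "(\<lambda>m. LINT x|D. ?s m x) \<longlonglongrightarrow> (LINT x|D. iexp (t * exp (- x)))"
    proof (rule integral_dominated_convergence[where w = "\<lambda>_. exp \<bar>t\<bar>"])
      show "AE x in D. (\<lambda>m. ?s m x) \<longlonglongrightarrow> iexp (t * exp (- x))"
      proof (rule AE_I2)
        fix x :: real
        have "(\<lambda>n. (\<i> * complex_of_real (t * exp (- x))) ^ n /\<^sub>R fact n) sums iexp (t * exp (- x))"
          by (rule exp_converges)
        moreover have "(\<i> * complex_of_real (t * exp (- x))) ^ n /\<^sub>R fact n
            = ?c t n * complex_of_real (exp (- real n * x))" for n
          using exp_of_nat_mult[of n "- x"]
          by (simp add: power_mult_distrib scaleR_conv_of_real divide_simps)
        ultimately show "(\<lambda>m. ?s m x) \<longlonglongrightarrow> iexp (t * exp (- x))"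
          by (simp add: sums_def)
      qed
      show "AE x in D. norm (?s m x) \<le> exp \<bar>t\<bar>" for m
        using D0
      proof eventually_elim
        fix x :: real assume x: "0 \<le> x"
        have "norm (?s m x) \<le> (\<Sum>n<m. norm (?c t n * complex_of_real (exp (- real n * x))))"
          by (rule norm_sum)
        also have "\<dots> \<le> (\<Sum>n<m. \<bar>t\<bar> ^ n /\<^sub>R fact n)"
        proof (rule sum_mono)
          fix n
          have "exp (- real n * x) \<le> 1" using x by simp
          then have "\<bar>t\<bar> ^ n / fact n * exp (- real n * x) \<le> \<bar>t\<bar> ^ n / fact n * 1"
            by (intro mult_left_mono) auto
          then show "norm (?c t n * complex_of_real (exp (- real n * x))) \<le> \<bar>t\<bar> ^ n /\<^sub>R fact n"
            by (simp add: norm_mult norm_divide norm_power divide_simps)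
        qed
        also have "\<dots> \<le> (\<Sum>n. \<bar>t\<bar> ^ n /\<^sub>R fact n)"
          by (rule sum_le_suminf[OF summable_exp_generic]) auto
        finally show "norm (?s m x) \<le> exp \<bar>t\<bar>"
          by (simp add: exp_def)
      qed
    qed auto
    moreover have "(LINT x|D. ?s m x)
        = (\<Sum>n<m. ?c t n * complex_of_real (LINT x|D. exp (- real n * x)))" for m
      using int by (subst Bochner_Integration.integral_sum) (auto simp flip: integral_complex_of_real)
    moreover have "char (distr D borel (\<lambda>x. exp (- x))) t = (LINT x|D. iexp (t * exp (- x)))"
      by (simp add: char_def integral_distr)
    ultimately show ?thesis by simp
  qed
  have distr_exp: "distr M borel (\<lambda>x. exp (- x)) = distr N borel (\<lambda>x. exp (- x))"
  proof (rule Levy_uniqueness)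
    interpret M: real_distribution M by (rule M)
    interpret N: real_distribution N by (rule N)
    show "real_distribution (distr M borel (\<lambda>x. exp (- x)))"
      by (rule M.real_distribution_distr) simp
    show "real_distribution (distr N borel (\<lambda>x. exp (- x)))"
      by (rule N.real_distribution_distr) simp
    show "char (distr M borel (\<lambda>x. exp (- x))) = char (distr N borel (\<lambda>x. exp (- x)))"
      by (rule ext, rule LIMSEQ_unique[OF char_series[OF M M0, unfolded eq] char_series[OF N N0]])
  qed
  have pull_back: "distr (distr D borel (\<lambda>x. exp (- x))) borel (\<lambda>y. - ln y) = D"
    if "real_distribution D" for D :: "real measure"
  proof -
    interpret D: real_distribution D by (rule that)
    show ?thesis
      by (subst distr_distr) (auto simp: o_def intro!: distr_id2)
  qed
  show ?thesis
    by (rule pull_back[OF M, unfolded distr_exp pull_back[OF N], symmetric])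
qed

text \<open>
  The integrand is again Gaussian, with variance \<open>1 / (1 + 2 * s)\<close>.
\<close>

lemma laplace_std_normal_square:
  fixes s :: real
  assumes "0 \<le> s"
  shows "(LINT x|std_normal_distribution. exp (- s * x\<^sup>2)) = (1 + 2 * s) powr (- 1 / 2)"
proof -
  define r where "r = 1 / sqrt (1 + 2 * s)"
  have r: "0 < r" "r\<^sup>2 = 1 / (1 + 2 * s)"
    using assms by (auto simp: r_def power_divide)
  have "std_normal_density x * exp (- s * x\<^sup>2) = r * normal_density 0 r x" for x
  proof -
    have "- x\<^sup>2 / 2 + - s * x\<^sup>2 = - x\<^sup>2 / (2 * r\<^sup>2)"
      using assms unfolding r(2) by (simp add: field_simps)
    moreover have "1 / sqrt (2 * pi) = r * (1 / sqrt (2 * pi * r\<^sup>2))"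
      using r(1) by (simp add: real_sqrt_mult)
    ultimately show ?thesis
      by (simp add: normal_density_def flip: exp_add)
  qed
  then have "(LINT x|std_normal_distribution. exp (- s * x\<^sup>2)) = (LINT x|lborel. r * normal_density 0 r x)"
    by (subst integral_density) auto
  also have "\<dots> = r" using r(1) by simp
  also have "\<dots> = (1 + 2 * s) powr (- 1 / 2)"
    using assms by (simp add: r_def powr_minus_divide powr_half_sqrt)
  finally show ?thesis .
qed

text \<open>
  The hypothesis says that all linear combinations of the \<open>Z i\<close> have the characteristic function of the
  corresponding combination of independent standard normal variables. Take independent standard normal
  weights \<open>g i\<close>, independent of the \<open>Z i\<close>, and compute the expectation of \<open>exp(i sqrt(2s) \<Sum>i. g i * Z i)\<close>
  twice: integrating over \<open>g\<close> first leaves \<open>exp(-s \<Sum>i. (Z i)\<^sup>2)\<close>, integrating over \<open>Z\<close> first leaves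
  \<open>exp(-s \<Sum>i. (g i)\<^sup>2)\<close>, whose expectation factorises.
\<close>

lemma (in prob_space) laplace_sum_squares_of_std_normal_char:
  fixes Z :: "'i \<Rightarrow> 'a \<Rightarrow> real"
  assumes fin: "finite I" and meas[measurable]: "\<And>i. i \<in> I \<Longrightarrow> Z i \<in> borel_measurable M"
    and char: "\<And>u. (LINT \<omega>|M. iexp (\<Sum>i\<in>I. u i * Z i \<omega>)) = complex_of_real (exp (- (\<Sum>i\<in>I. (u i)\<^sup>2) / 2))"
    and s: "0 \<le> s"
  shows "expectation (\<lambda>\<omega>. exp (- s * (\<Sum>i\<in>I. (Z i \<omega>)\<^sup>2))) = (1 + 2 * s) powr (- real (card I) / 2)"
proof -
  interpret G: real_distribution std_normal_distribution by (rule real_dist_normal_dist)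
  interpret P: product_prob_space "\<lambda>_::'i. std_normal_distribution" I by standard
  let ?P = "\<Pi>\<^sub>M i\<in>I. std_normal_distribution"
  interpret MP: pair_prob_space M ?P by standard
  let ?r = "sqrt (2 * s)"
  let ?f = "\<lambda>\<omega> g. iexp (\<Sum>i\<in>I. ?r * g i * Z i \<omega>)"
  have [measurable]: "(\<lambda>x. ?f (fst x) (snd x)) \<in> borel_measurable (M \<Otimes>\<^sub>M ?P)"
    by measurable
  have int: "integrable (M \<Otimes>\<^sub>M ?P) (\<lambda>(\<omega>, g). ?f \<omega> g)"
    by (rule MP.integrable_const_bound[of _ 1]) (auto simp: split_beta')
  have 1: "(LINT g|?P. ?f \<omega> g) = complex_of_real (exp (- s * (\<Sum>i\<in>I. (Z i \<omega>)\<^sup>2)))" for \<omega>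
  proof -
    have "(LINT g|?P. ?f \<omega> g) = (LINT g|?P. (\<Prod>i\<in>I. iexp (?r * Z i \<omega> * g i)))"
      using fin by (simp add: exp_sum sum_distrib_left mult_ac)
    also have "\<dots> = (\<Prod>i\<in>I. (LINT y|std_normal_distribution. iexp (?r * Z i \<omega> * y)))"
      by (rule P.product_integral_prod[OF fin]) (rule G.integrable_iexp, auto)
    also have "\<dots> = (\<Prod>i\<in>I. char std_normal_distribution (?r * Z i \<omega>))"
      by (simp add: char_def)
    also have "\<dots> = complex_of_real (\<Prod>i\<in>I. exp (- s * (Z i \<omega>)\<^sup>2))"
      using s by (simp add: char_std_normal_distribution power_mult_distrib)
    also have "(\<Prod>i\<in>I. exp (- s * (Z i \<omega>)\<^sup>2)) = exp (- s * (\<Sum>i\<in>I. (Z i \<omega>)\<^sup>2))"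
      using fin by (simp only: exp_sum[symmetric] sum_distrib_left)
    finally show ?thesis .
  qed
  have 2: "(LINT \<omega>|M. ?f \<omega> g) = complex_of_real (\<Prod>i\<in>I. exp (- s * (g i)\<^sup>2))" for g
  proof -
    have "(LINT \<omega>|M. ?f \<omega> g) = complex_of_real (exp (- (\<Sum>i\<in>I. (?r * g i)\<^sup>2) / 2))"
      by (rule char)
    also have "- (\<Sum>i\<in>I. (?r * g i)\<^sup>2) / 2 = (\<Sum>i\<in>I. - s * (g i)\<^sup>2)"
      using s by (simp add: power_mult_distrib sum_distrib_left sum_divide_distrib sum_negf)
    finally show ?thesis using fin by (simp only: exp_sum)
  qed
  have "complex_of_real (LINT \<omega>|M. exp (- s * (\<Sum>i\<in>I. (Z i \<omega>)\<^sup>2))) = (LINT \<omega>|M. (LINT g|?P. ?f \<omega> g))"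
    unfolding 1 by (rule integral_complex_of_real[symmetric])
  also have "\<dots> = (LINT g|?P. (LINT \<omega>|M. ?f \<omega> g))"
    by (rule MP.Fubini_integral[symmetric]) (rule int)
  also have "\<dots> = complex_of_real (LINT g|?P. (\<Prod>i\<in>I. exp (- s * (g i)\<^sup>2)))"
    unfolding 2 by (rule integral_complex_of_real)
  also have "(LINT g|?P. (\<Prod>i\<in>I. exp (- s * (g i)\<^sup>2))) = (\<Prod>i\<in>I. (1 + 2 * s) powr (- 1 / 2))"
    using s laplace_std_normal_square[OF s] by (subst P.product_integral_prod[OF fin])
      (auto intro!: G.integrable_const_bound[of _ 1])
  also have "\<dots> = (1 + 2 * s) powr (- real (card I) / 2)"
    using s by (simp add: powr_realpow[symmetric] powr_powr)
  finally show ?thesis by (simp only: of_real_eq_iff)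
qed

lemma has_bochner_integral_gamma_density:
  fixes p c :: real
  assumes p: "0 < p" and c: "0 < c"
  shows "has_bochner_integral lborel (\<lambda>x. indicator {0..} x * x powr (p - 1) * exp (- (c * x))) (Gamma p / c powr p)"
proof -
  let ?g = "\<lambda>t::real. indicator {0..} t * t powr (p - 1) / exp t"
  have "has_bochner_integral lborel ?g (Gamma p)"
    using p Gamma_conv_nn_integral_real[OF p] Gamma_real_pos[OF p]
    by (intro has_bochner_integral_nn_integral) auto
  then have "has_bochner_integral lborel (\<lambda>x. ?g (0 + c * x)) (Gamma p /\<^sub>R \<bar>c\<bar>)"
    using c by (subst (asm) lborel_has_bochner_integral_real_affine_iff[of c _ _ 0]) auto
  then have "has_bochner_integral lborel (\<lambda>x. ?g (c * x) * c powr (1 - p)) (Gamma p /\<^sub>R \<bar>c\<bar> * c powr (1 - p))"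
    by (intro has_bochner_integral_mult_left) auto
  moreover have "?g (c * x) * c powr (1 - p) = indicator {0..} x * x powr (p - 1) * exp (- (c * x))" for x
  proof -
    have "c powr (p - 1) * c powr (1 - p) = 1" using c by (simp flip: powr_add)
    then show ?thesis
      using c by (auto simp: indicator_def powr_mult exp_minus divide_inverse zero_le_mult_iff mult_ac)
  qed
  moreover have "Gamma p /\<^sub>R \<bar>c\<bar> * c powr (1 - p) = Gamma p / c powr p"
    using c by (simp add: powr_diff divide_simps)
  ultimately show ?thesis by simp
qed

lemma chi_squared_density_nonneg: "1 \<le> K \<Longrightarrow> 0 \<le> chi_squared_density K x"
  by (auto simp: chi_squared_density_def intro!: divide_nonneg_nonneg mult_nonneg_nonneg less_imp_le[OF Gamma_real_pos])

lemma measurable_chi_squared_density[measurable]: "chi_squared_density K \<in> borel_measurable borel"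
  unfolding chi_squared_density_def[abs_def] by measurable

text \<open>
  Total mass, Laplace transform and moments are all instances of one Gamma integral, with \<open>c = 0\<close> or \<open>n = 0\<close>.
\<close>

lemma chi_squared_density_moment_laplace:
  fixes c :: real
  assumes K: "1 \<le> K" and c: "0 \<le> c"
  shows "has_bochner_integral lborel (\<lambda>x. chi_squared_density K x * (x ^ n * exp (- (c * x))))
     (2 ^ n * pochhammer (real K / 2) n * (1 + 2 * c) powr (- (real K / 2 + real n)))"
proof -
  let ?p = "real K / 2" and ?C = "2 powr (real K / 2) * Gamma (real K / 2)"
  have G: "Gamma ?p > 0" using K by (intro Gamma_real_pos) simp
  have hbi: "has_bochner_integral lborel
     (\<lambda>x. indicator {0..} x * x powr (?p + n - 1) * exp (- ((1 / 2 + c) * x)) / ?C)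
     (Gamma (?p + n) / (1 / 2 + c) powr (?p + n) / ?C)"
    using K c by (intro has_bochner_integral_divide has_bochner_integral_gamma_density) auto
  have val: "Gamma (?p + n) / (1 / 2 + c) powr (?p + n) / ?C
      = 2 ^ n * pochhammer ?p n * (1 + 2 * c) powr (- (?p + n))"
  proof -
    have "?p \<notin> \<int>\<^sub>\<le>\<^sub>0" using K by (auto elim!: nonpos_Ints_cases)
    then have "Gamma (?p + n) = pochhammer ?p n * Gamma ?p"
      using G by (simp add: pochhammer_Gamma)
    moreover have "1 / 2 + c = (1 + 2 * c) / 2" by (simp add: field_simps)
    then have "(1 / 2 + c) powr (?p + n) = (1 + 2 * c) powr (?p + n) / (2 powr ?p * 2 ^ n)"
      using c by (simp only:) (simp add: powr_divide powr_add powr_realpow power_divide)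
    ultimately show ?thesis
      using G c by (simp add: powr_minus_divide del: minus_add_distrib)
  qed
  have ae: "AE x in lborel. indicator {0..} x * x powr (?p + n - 1) * exp (- ((1 / 2 + c) * x)) / ?C
      = chi_squared_density K x * (x ^ n * exp (- (c * x)))"
  proof -
    have eq: "indicator {0..} x * x powr (?p + n - 1) * exp (- ((1 / 2 + c) * x)) / ?C
      = chi_squared_density K x * (x ^ n * exp (- (c * x)))" if "x \<noteq> 0" for x :: real
    proof (cases "x < 0")
      case False
      with that have x: "x > 0" by simp
      have "x powr (?p + n - 1) = x powr (?p - 1) * x ^ n"
        using x powr_add[of x "?p - 1" "real n"] by (simp add: powr_realpow algebra_simps)
      moreover have "exp (- ((1 / 2 + c) * x)) = exp (- x / 2) * exp (- (c * x))"
        by (simp add: algebra_simps flip: exp_add)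
      ultimately show ?thesis using x by (simp add: chi_squared_density_def)
    qed (simp add: chi_squared_density_def)
    show ?thesis
      using AE_lborel_singleton[of "0::real"] by (rule eventually_mono) (rule eq)
  qed
  show ?thesis
    using hbi unfolding val
    by (rule has_bochner_integral_cong_AE[THEN iffD1, OF _ _ ae, rotated 2]) measurable
qed

lemma (in prob_space) sum_squares_distributed_chi_squared:
  fixes Z :: "'i \<Rightarrow> 'a \<Rightarrow> real"
  assumes fin: "finite I" and I: "I \<noteq> {}"
    and meas[measurable]: "\<And>i. i \<in> I \<Longrightarrow> Z i \<in> borel_measurable M"
    and char: "\<And>u. (LINT \<omega>|M. iexp (\<Sum>i\<in>I. u i * Z i \<omega>)) = complex_of_real (exp (- (\<Sum>i\<in>I. (u i)\<^sup>2) / 2))"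
  shows "distributed M lborel (\<lambda>\<omega>. \<Sum>i\<in>I. (Z i \<omega>)\<^sup>2) (chi_squared_density (card I))"
proof -
  let ?K = "card I" and ?Q = "\<lambda>\<omega>. \<Sum>i\<in>I. (Z i \<omega>)\<^sup>2"
  let ?N = "density lborel (\<lambda>x. ennreal (chi_squared_density ?K x))"
  have K: "1 \<le> ?K" using fin I by (simp add: Suc_le_eq card_gt_0_iff)
  note nonneg = chi_squared_density_nonneg[OF K]
  have "has_bochner_integral lborel (chi_squared_density ?K) 1"
    using chi_squared_density_moment_laplace[OF K, of 0 0] by simp
  then have "prob_space ?N"
    using nonneg by (intro prob_spaceI)
      (simp add: emeasure_density nn_integral_eq_integral has_bochner_integral_iff)
  then interpret N: real_distribution ?N
    by (simp add: real_distribution_def real_distribution_axioms_def)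
  have "distr M borel ?Q = ?N"
  proof (rule real_distribution_eqI_laplace_nat)
    show "real_distribution (distr M borel ?Q)"
      by (rule real_distribution_distr) measurable
    show "real_distribution ?N" by unfold_locales
    show "AE x in distr M borel ?Q. 0 \<le> x"
      by (subst AE_distr_iff) (auto intro!: sum_nonneg)
    show "AE x in ?N. 0 \<le> x"
      by (subst AE_density) (auto simp: chi_squared_density_def)
    fix n :: nat
    have "(LINT x|distr M borel ?Q. exp (- real n * x)) = expectation (\<lambda>\<omega>. exp (- real n * ?Q \<omega>))"
      by (rule integral_distr) measurable
    also have "\<dots> = (1 + 2 * real n) powr (- real ?K / 2)"
      by (rule laplace_sum_squares_of_std_normal_char[OF fin meas char]) auto
    also have "\<dots> = (LINT x|lborel. chi_squared_density ?K x * exp (- real n * x))"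
      using chi_squared_density_moment_laplace[OF K, of "real n" 0]
      by (simp add: has_bochner_integral_iff)
    also have "\<dots> = (LINT x|?N. exp (- real n * x))"
      using nonneg by (subst integral_density) auto
    finally show "(LINT x|distr M borel ?Q. exp (- real n * x)) = (LINT x|?N. exp (- real n * x))" .
  qed
  then show ?thesis
    by (auto simp: distributed_def cong: distr_cong)
qed

lemma (in prob_space) chi_squared_distributed_expectation_variance:
  assumes D: "distributed M lborel Q (chi_squared_density K)" and K: "1 \<le> K"
  shows "expectation Q = real K" and "variance Q = 2 * real K"
proof -
  have int: "integrable M (\<lambda>x. Q x ^ n)"
    and val: "expectation (\<lambda>x. Q x ^ n) = 2 ^ n * pochhammer (real K / 2) n" for n
    using chi_squared_density_moment_laplace[OF K order_refl, of n]
      distributed_integrable[OF D, of "\<lambda>x. x ^ n"] distributed_integral[OF D, of "\<lambda>x. x ^ n"]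
      chi_squared_density_nonneg[OF K]
    by (auto simp: has_bochner_integral_iff)
  show E: "expectation Q = real K"
    using val[of 1] by simp
  show "variance Q = 2 * real K"
    using int[of 1] int[of 2] val[of 2] E
    by (simp add: variance_eq pochhammer_Suc numeral_2_eq_2 algebra_simps power2_eq_square prob_space)
qed

section \<open>Gaussian random functions\<close>

lemma gaussian_process_coordinate:
  assumes "prob_space M" and X: "gaussian_process M T X" and t: "t \<in> T"
  shows "square_integrable M (\<lambda>\<omega>. X \<omega> t)"
proof -
  interpret prob_space M by (rule assms(1))
  have "normal_rv M (\<lambda>\<omega>. \<Sum>s\<in>{t}. 1 * X \<omega> s)"
    using t by (intro X[unfolded gaussian_process_def, rule_format]) auto
  from normal_rv_centered(1)[OF this] show ?thesis by simp
qed

text \<open>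
  These are the approximants to the scores: they already satisfy the Gaussian characteristic identity.
\<close>

lemma gaussian_process_centered_sum:
  fixes c :: "real \<Rightarrow> real"
  assumes "prob_space M" and X: "gaussian_process M T X" and J: "finite J" "J \<subseteq> T"
  defines "V \<equiv> \<lambda>\<omega>. \<Sum>t\<in>J. c t * (X \<omega> t - mean_fun M X t)"
  shows "square_integrable M V"
    and "(LINT \<omega>|M. iexp (V \<omega>)) = complex_of_real (exp (- (LINT \<omega>|M. (V \<omega>)\<^sup>2) / 2))"
proof -
  interpret prob_space M by (rule assms(1))
  let ?W = "\<lambda>\<omega>. \<Sum>t\<in>J. c t * X \<omega> t"
  have normal: "normal_rv M ?W"
    using X J by (simp add: gaussian_process_def)
  have "integrable M (\<lambda>\<omega>. X \<omega> t)" if "t \<in> J" for t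
    using gaussian_process_coordinate[OF assms(1) X] J that
    by (blast intro: integrable_of_square_integrable)
  then have "expectation ?W = (\<Sum>t\<in>J. c t * mean_fun M X t)"
    by (simp add: mean_fun_def)
  then have V: "V = (\<lambda>\<omega>. ?W \<omega> - expectation ?W)"
    unfolding V_def by (simp add: algebra_simps sum_subtractf)
  show "square_integrable M V"
    unfolding V by (intro square_integrable_diff normal_rv_centered(1)[OF normal] square_integrable_const)
  show "(LINT \<omega>|M. iexp (V \<omega>)) = complex_of_real (exp (- (LINT \<omega>|M. (V \<omega>)\<^sup>2) / 2))"
    unfolding V by (rule normal_rv_centered(2)[OF normal])
qed

text \<open>
  The fourth moment of the norm dominates the second, which by Fubini is the joint second moment.
\<close>

lemma square_integrable_functional_rv:
  assumes "prob_space M" and "sigma_finite_measure (lebesgue_on T)"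
    and X: "functional_rv M T X" and mom: "integrable M (\<lambda>\<omega>. L2_norm T (X \<omega>) ^ 4)"
  shows "square_integrable (M \<Otimes>\<^sub>M lebesgue_on T) (\<lambda>(\<omega>, t). X \<omega> t)"
proof -
  interpret prob_space M by (rule assms(1))
  interpret N: sigma_finite_measure "lebesgue_on T" by (rule assms(2))
  interpret pair_sigma_finite M "lebesgue_on T" ..
  let ?N = "lebesgue_on T"
  have Xm[measurable]: "(\<lambda>(\<omega>, t). X \<omega> t) \<in> borel_measurable (M \<Otimes>\<^sub>M ?N)"
    and L2: "\<And>\<omega>. \<omega> \<in> space M \<Longrightarrow> X \<omega> \<in> L2_space T"
    using X by (auto simp: functional_rv_def)
  have norm_eq: "(LINT t|?N. (X \<omega> t)\<^sup>2) = (L2_norm T (X \<omega>))\<^sup>2" for \<omega>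
    by (simp add: L2_norm_def L2_inner_def power2_eq_square)
  have "integrable (M \<Otimes>\<^sub>M ?N) (\<lambda>(\<omega>, t). (X \<omega> t)\<^sup>2)"
  proof (rule Fubini_integrable)
    show "(\<lambda>(\<omega>, t). (X \<omega> t)\<^sup>2) \<in> borel_measurable (M \<Otimes>\<^sub>M ?N)" by measurable
    show "integrable M (\<lambda>\<omega>. LINT t|?N. norm (case (\<omega>, t) of (\<omega>, t) \<Rightarrow> (X \<omega> t)\<^sup>2))"
    proof (rule Bochner_Integration.integrable_bound)
      show "integrable M (\<lambda>\<omega>. 1 + L2_norm T (X \<omega>) ^ 4)"
        using mom by simp
      show "(\<lambda>\<omega>. LINT t|?N. norm (case (\<omega>, t) of (\<omega>, t) \<Rightarrow> (X \<omega> t)\<^sup>2)) \<in> borel_measurable M"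
        by measurable
      have "r\<^sup>2 \<le> 1 + r ^ 4" for r :: real
      proof -
        have "0 \<le> (r\<^sup>2 - 1)\<^sup>2 + r\<^sup>2" by simp
        then show ?thesis by (simp add: power2_eq_square algebra_simps eval_nat_numeral)
      qed
      then show "AE \<omega> in M. norm (LINT t|?N. norm (case (\<omega>, t) of (\<omega>, t) \<Rightarrow> (X \<omega> t)\<^sup>2))
          \<le> norm (1 + L2_norm T (X \<omega>) ^ 4)"
        by (simp add: norm_eq)
    qed
    show "AE \<omega> in M. integrable ?N (\<lambda>t. case (\<omega>, t) of (\<omega>, t) \<Rightarrow> (X \<omega> t)\<^sup>2)"
      using L2 by (auto simp: L2_space_def)
  qed
  then show ?thesis
    using Xm by (simp add: square_integrable_def split_beta')
qed

text \<open>
  By Jensen's inequality the squared mean is at most the second moment, which Fubini makes integrable.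
\<close>

lemma square_integrable_mean_fun:
  assumes "prob_space M" and "sigma_finite_measure (lebesgue_on T)"
    and X: "square_integrable (M \<Otimes>\<^sub>M lebesgue_on T) (\<lambda>(\<omega>, t). X \<omega> t)"
    and coord: "\<And>t. t \<in> T \<Longrightarrow> square_integrable M (\<lambda>\<omega>. X \<omega> t)"
  shows "square_integrable (lebesgue_on T) (mean_fun M X)"
  unfolding square_integrable_def
proof
  interpret prob_space M by (rule assms(1))
  interpret N: sigma_finite_measure "lebesgue_on T" by (rule assms(2))
  interpret pair_sigma_finite M "lebesgue_on T" ..
  let ?N = "lebesgue_on T"
  note [measurable] = square_integrable_measurable[OF X]
  show [measurable]: "mean_fun M X \<in> borel_measurable ?N"
    unfolding mean_fun_def[abs_def] by measurable
  have X2: "integrable (M \<Otimes>\<^sub>M ?N) (\<lambda>(\<omega>, t). (X \<omega> t)\<^sup>2)"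
    using square_integrableD[OF X] by (simp add: split_beta')
  show "integrable ?N (\<lambda>t. (mean_fun M X t)\<^sup>2)"
  proof (rule Bochner_Integration.integrable_bound)
    show "integrable ?N (\<lambda>t. LINT \<omega>|M. (X \<omega> t)\<^sup>2)"
      by (rule integrable_snd[OF X2])
    show "AE t in ?N. norm ((mean_fun M X t)\<^sup>2) \<le> norm (LINT \<omega>|M. (X \<omega> t)\<^sup>2)"
      using square_expectation_le[OF coord] by (auto simp: mean_fun_def)
  qed measurable
qed

text \<open>
  Parseval's identity for the finite eigenfunction expansion of the regularised variable.
\<close>

lemma d_FM_square_eq:
  assumes orth: "L2_orthonormal_basis T \<psi>"
    and pos: "\<And>k. k \<in> {1..K} \<Longrightarrow> 0 < lam k"
  shows "(d_FM T lam \<psi> K x m)\<^sup>2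
    = (\<Sum>k=1..K. (L2_inner T (\<psi> k) (\<lambda>t. x t - m t) / sqrt (lam k))\<^sup>2)"
proof -
  let ?N = "lebesgue_on T"
  let ?a = "\<lambda>k. L2_inner T (\<psi> k) (\<lambda>t. x t - m t) / sqrt (lam k)"
  have \<psi>: "square_integrable ?N (\<psi> k)" if "k \<in> {1..K}" for k
    using orth that by (auto simp: L2_orthonormal_basis_def L2_space_def square_integrable_def)
  have inner: "(LINT t|?N. \<psi> j t * \<psi> k t) = (if j = k then 1 else 0)" if "j \<in> {1..K}" "k \<in> {1..K}" for j k
    using orth that by (auto simp: L2_orthonormal_basis_def L2_inner_def)
  have reg_eq: "reg_inv_sqrt T lam \<psi> K (\<lambda>t. x t - m t) = (\<lambda>t. \<Sum>k=1..K. ?a k * \<psi> k t)"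
    by (simp add: reg_inv_sqrt_def[abs_def] tensor_square_def)
  have "L2_inner T (\<lambda>t. \<Sum>k=1..K. ?a k * \<psi> k t) (\<lambda>t. \<Sum>k=1..K. ?a k * \<psi> k t) = (\<Sum>k=1..K. (?a k)\<^sup>2)"
    unfolding L2_inner_def power2_eq_square[symmetric]
    by (rule integral_square_sum_orthonormal[OF _ \<psi> inner, unfolded L2_inner_def]) auto
  then show ?thesis
    unfolding d_FM_def reg_eq by (simp add: sum_nonneg)
qed

theorem theorem2p1:
  fixes a b :: real and T :: "real set"
    and M :: "'w measure" and X :: "'w \<Rightarrow> real \<Rightarrow> real"
    and lam :: "nat \<Rightarrow> real" and \<psi> :: "nat \<Rightarrow> real \<Rightarrow> real" and K :: nat
  assumes "a < b" and "T = {a..b}"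
    and "prob_space M"
    and "functional_rv M T X"
    and "integrable M (\<lambda>\<omega>. L2_norm T (X \<omega>) ^ 4)"
    and "L2_compact_op T (cov_op M T X)"
    and "eigensystem T (cov_op M T X) lam \<psi>"
    and "1 \<le> K" and "lam K > 0"
    and "gaussian_process M T X"
  shows "distributed M lborel (\<lambda>\<omega>. (d_FM T lam \<psi> K (X \<omega>) (mean_fun M X))\<^sup>2) (chi_squared_density K)
    \<and> prob_space.expectation M (\<lambda>\<omega>. (d_FM T lam \<psi> K (X \<omega>) (mean_fun M X))\<^sup>2) = real K
    \<and> prob_space.variance M (\<lambda>\<omega>. (d_FM T lam \<psi> K (X \<omega>) (mean_fun M X))\<^sup>2) = 2 * real K"
proof -
  interpret prob_space M by (rule assms(3))
  let ?N = "lebesgue_on T"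
  interpret N: finite_measure ?N
    unfolding assms(2) by (rule finite_measure_lebesgue_on) simp
  interpret pair_sigma_finite M ?N ..
  define Xc where "Xc \<omega> t = X \<omega> t - mean_fun M X t" for \<omega> t
  define Y where "Y k \<omega> = L2_inner T (\<psi> k) (Xc \<omega>)" for k \<omega>
  define Z where "Z k \<omega> = Y k \<omega> / sqrt (lam k)" for k \<omega>
  note X_coord = gaussian_process_coordinate[OF assms(3,10)]
  have X: "square_integrable (M \<Otimes>\<^sub>M ?N) (\<lambda>(\<omega>, t). X \<omega> t)"
    by (rule square_integrable_functional_rv[OF assms(3) N.sigma_finite_measure_axioms assms(4,5)])
  have mean: "square_integrable ?N (mean_fun M X)"
    by (rule square_integrable_mean_fun[OF assms(3) N.sigma_finite_measure_axioms X X_coord])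
  have Xc: "square_integrable (M \<Otimes>\<^sub>M ?N) (\<lambda>(\<omega>, t). Xc \<omega> t)"
    using square_integrable_diff[OF X square_integrable_tensor[OF square_integrable_const[of 1] mean]]
    by (simp add: Xc_def split_beta')
  have Xc_path: "square_integrable ?N (Xc \<omega>)" if "\<omega> \<in> space M" for \<omega>
    unfolding Xc_def using assms(4) that
    by (intro square_integrable_diff mean)
      (auto simp: functional_rv_def L2_space_def square_integrable_def)
  have Xc_coord: "square_integrable M (\<lambda>\<omega>. Xc \<omega> t)" if "t \<in> space ?N" for t
    unfolding Xc_def using that
    by (intro square_integrable_diff X_coord square_integrable_const) simp
  \<comment> \<open>Every score, and every combination of scores, is centred Gaussian.\<close>
  have gauss: "(LINT \<omega>|M. iexp (LINT t|?N. \<phi> t * Xc \<omega> t))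
      = complex_of_real (exp (- expectation (\<lambda>\<omega>. (LINT t|?N. \<phi> t * Xc \<omega> t)\<^sup>2) / 2))"
    if \<phi>: "square_integrable ?N \<phi>" for \<phi>
  proof (rule gaussian_char_L2_closed)
    show "square_integrable M (\<lambda>\<omega>. LINT t|?N. \<phi> t * Xc \<omega> t)"
      by (rule square_integrable_partial_pairing[OF \<phi> Xc])
    fix \<epsilon> :: real assume "0 < \<epsilon>"
    from partial_pairing_approximable[OF \<phi> Xc Xc_coord this]
    obtain J c where J: "finite J" "J \<subseteq> T"
      and close: "expectation (\<lambda>\<omega>. ((LINT t|?N. \<phi> t * Xc \<omega> t) - (\<Sum>t\<in>J. c t * Xc \<omega> t))\<^sup>2) < \<epsilon>"
      by auto
    show "\<exists>V. square_integrable M V \<and> expectation (\<lambda>\<omega>. ((LINT t|?N. \<phi> t * Xc \<omega> t) - V \<omega>)\<^sup>2) < \<epsilon>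
       \<and> (LINT \<omega>|M. iexp (V \<omega>)) = complex_of_real (exp (- expectation (\<lambda>\<omega>. (V \<omega>)\<^sup>2) / 2))"
      using close gaussian_process_centered_sum[OF assms(3,10) J, of c]
      unfolding Xc_def by (intro exI conjI)
  qed
  \<comment> \<open>The sequence is monotone from index 1 on only.\<close>
  have decreasing: "\<And>k. 1 \<le> k \<Longrightarrow> lam (Suc k) \<le> lam k" and orth: "L2_orthonormal_basis T \<psi>"
    and eigen: "\<And>k. 1 \<le> k \<Longrightarrow> AE t in ?N. cov_op M T X (\<psi> k) t = lam k * \<psi> k t"
    using assms(7) by (auto simp: eigensystem_def)
  have lam_pos: "0 < lam k" if "k \<in> {1..K}" for k
  proof -
    have "k \<le> K" using that by simp
    then have "lam K \<le> lam k"
      by (induction K rule: dec_induct) (use decreasing that in \<open>auto intro: order_trans\<close>)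
    with assms(9) show ?thesis by simp
  qed
  have \<psi>: "square_integrable ?N (\<psi> k)" if "1 \<le> k" for k
    using orth that by (auto simp: L2_orthonormal_basis_def L2_space_def square_integrable_def)
  have Y_eq: "Y k \<omega> = (LINT t|?N. \<psi> k t * Xc \<omega> t)" for k \<omega>
    by (simp add: Y_def L2_inner_def)
  have Y: "square_integrable M (Y k)" if "1 \<le> k" for k
    unfolding Y_eq[abs_def] by (rule square_integrable_partial_pairing[OF \<psi>[OF that] Xc])
  have cov_Y: "expectation (\<lambda>\<omega>. Y j \<omega> * Y k \<omega>) = (if j = k then lam k else 0)" if "1 \<le> j" "1 \<le> k" for j k
  proof -
    have "expectation (\<lambda>\<omega>. Y j \<omega> * Y k \<omega>) = (LINT t|?N. \<psi> k t * (LINT \<omega>|M. Y j \<omega> * Xc \<omega> t))"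
      unfolding Y_eq[of k] by (rule integral_pairing(1)[OF Y[OF that(1)] \<psi>[OF that(2)] Xc])
    also have "\<dots> = (LINT t|?N. \<psi> k t * cov_op M T X (\<psi> j) t)"
      by (simp add: cov_op_def Y_def Xc_def L2_inner_def mult_ac)
    also have "\<dots> = (LINT t|?N. lam j * (\<psi> j t * \<psi> k t))"
    proof (rule integral_cong_AE)
      note [measurable] = square_integrable_measurable[OF \<psi>[OF that(1)]] square_integrable_measurable[OF \<psi>[OF that(2)]]
        square_integrable_measurable[OF Xc] square_integrable_measurable[OF Y[OF that(1)]]
      have "cov_op M T X (\<psi> j) = (\<lambda>t. LINT \<omega>|M. Y j \<omega> * Xc \<omega> t)"
        by (simp add: cov_op_def Y_def Xc_def L2_inner_def mult_ac fun_eq_iff)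
      moreover have "(\<lambda>t. LINT \<omega>|M. Y j \<omega> * Xc \<omega> t) \<in> borel_measurable ?N" by measurable
      ultimately show "(\<lambda>t. \<psi> k t * cov_op M T X (\<psi> j) t) \<in> borel_measurable ?N"
        by simp
      show "(\<lambda>t. lam j * (\<psi> j t * \<psi> k t)) \<in> borel_measurable ?N" by measurable
      show "AE t in ?N. \<psi> k t * cov_op M T X (\<psi> j) t = lam j * (\<psi> j t * \<psi> k t)"
        using eigen[OF that(1)] by eventually_elim simp
    qed
    also have "\<dots> = lam j * L2_inner T (\<psi> j) (\<psi> k)"
      by (simp add: L2_inner_def)
    also have "\<dots> = (if j = k then lam k else 0)"
      using orth that by (simp add: L2_orthonormal_basis_def)
    finally show ?thesis .
  qed
  have Z: "square_integrable M (Z k)" if "k \<in> {1..K}" for k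
    using square_integrable_cmult[OF Y, of k "1 / sqrt (lam k)"] that by (simp add: Z_def[abs_def])
  have cov_Z: "expectation (\<lambda>\<omega>. Z j \<omega> * Z k \<omega>) = (if j = k then 1 else 0)" if "j \<in> {1..K}" "k \<in> {1..K}" for j k
    using cov_Y[of j k] that lam_pos[of k] by (simp add: Z_def)
  have char_Z: "(LINT \<omega>|M. iexp (\<Sum>k=1..K. u k * Z k \<omega>)) = complex_of_real (exp (- (\<Sum>k=1..K. (u k)\<^sup>2) / 2))" for u
  proof -
    let ?\<phi> = "\<lambda>t. \<Sum>k=1..K. (u k / sqrt (lam k)) * \<psi> k t"
    have \<phi>: "square_integrable ?N ?\<phi>"
      by (intro square_integrable_sum square_integrable_cmult \<psi>) simp
    have pairing: "(LINT t|?N. ?\<phi> t * Xc \<omega> t) = (\<Sum>k=1..K. u k * Z k \<omega>)" if "\<omega> \<in> space M" for \<omega>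
    proof -
      have "(LINT t|?N. ?\<phi> t * Xc \<omega> t) = (LINT t|?N. (\<Sum>k=1..K. (u k / sqrt (lam k)) * (\<psi> k t * Xc \<omega> t)))"
        by (simp add: sum_distrib_right mult.assoc)
      also have "\<dots> = (\<Sum>k=1..K. LINT t|?N. (u k / sqrt (lam k)) * (\<psi> k t * Xc \<omega> t))"
        by (intro Bochner_Integration.integral_sum integrable_mult_right
            integrable_mult_square_integrable \<psi> Xc_path that) simp
      also have "\<dots> = (\<Sum>k=1..K. u k * Z k \<omega>)"
        by (simp only: integral_mult_right_zero) (simp add: Z_def Y_eq)
      finally show ?thesis .
    qed
    have "(LINT \<omega>|M. iexp (\<Sum>k=1..K. u k * Z k \<omega>)) = (LINT \<omega>|M. iexp (LINT t|?N. ?\<phi> t * Xc \<omega> t))"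
      by (rule Bochner_Integration.integral_cong) (simp_all only: pairing)
    also have "\<dots> = complex_of_real (exp (- expectation (\<lambda>\<omega>. (LINT t|?N. ?\<phi> t * Xc \<omega> t)\<^sup>2) / 2))"
      by (rule gauss[OF \<phi>])
    also have "expectation (\<lambda>\<omega>. (LINT t|?N. ?\<phi> t * Xc \<omega> t)\<^sup>2) = expectation (\<lambda>\<omega>. (\<Sum>k=1..K. u k * Z k \<omega>)\<^sup>2)"
      by (rule Bochner_Integration.integral_cong) (simp_all only: pairing)
    also have "\<dots> = (\<Sum>k=1..K. (u k)\<^sup>2)"
      by (rule integral_square_sum_orthonormal[OF _ Z cov_Z]) auto
    finally show ?thesis .
  qed
  have d_eq: "(d_FM T lam \<psi> K (X \<omega>) (mean_fun M X))\<^sup>2 = (\<Sum>k=1..K. (Z k \<omega>)\<^sup>2)" for \<omega>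
    unfolding Z_def Y_def Xc_def by (rule d_FM_square_eq[OF orth lam_pos])
  have "distributed M lborel (\<lambda>\<omega>. \<Sum>k=1..K. (Z k \<omega>)\<^sup>2) (chi_squared_density (card {1..K}))"
    using assms(8) by (intro sum_squares_distributed_chi_squared char_Z) (auto intro: square_integrable_measurable[OF Z])
  then have D: "distributed M lborel (\<lambda>\<omega>. (d_FM T lam \<psi> K (X \<omega>) (mean_fun M X))\<^sup>2) (chi_squared_density K)"
    by (simp add: d_eq)
  then show ?thesis
    using chi_squared_distributed_expectation_variance[OF D assms(8)] by simp
qed

end
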